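(* Let $n\ge1$ and let $L_n$ be the linear hexagonal chain with vertices $p_0,\dots,p_n,q_0,\dots,q_n,u_0,\dots,u_{n-1},v_0,\dots,v_{n-1}$ and edges $p_iq_i$ $(0\le i\le n)$ and $p_iu_i,\ u_ip_{i+1},\ q_iv_i,\ v_iq_{i+1}$ $(0\le i\le n-1)$; let $r$ denote resistance distance in $L_n$. Then: (i) $r(p_0,p_n)\ge r(p_j,p_i)\ge r(p_{\lfloor\frac{n-1}{2}\rfloor},p_{\lfloor\frac{n-1}{2}\rfloor+1})$ for $0\le j<i\le n$; (ii) $r(q_0,p_n)\ge r(q_j,p_i)\ge r(q_{\lfloor\frac n2\rfloor},p_{\lfloor\frac n2\rfloor})$ for $0\le j\le i\le n$; (iii) $r(u_0,u_{n-1})\ge r(u_j,u_i)\ge r(u_{\lfloor\frac{n-1}{2}\rfloor},u_{\lfloor\frac{n-1}{2}\rfloor+1})$ for $0\le j<i\le n-1$; (iv) $r(v_0,u_{n-1})\ge r(v_j,u_i)\ge r(v_{\lfloor\frac n2\rfloor},u_{\lfloor\frac n2\rfloor})$ for $0\le j\le i\le n-1$; (v) $r(p_0,u_{n-1})\ge r(p_j,u_i)\ge r(p_{\lfloor\frac n2\rfloor},u_{\lfloor\frac n2\rfloor})$ for $0\le j\le i\le n-1$; (vi) $r(p_0,v_{n-1})\ge r(p_j,v_i)\ge r(p_{\lfloor\frac n2\rfloor},v_{\lfloor\frac n2\rfloor})$ for $0\le j\le i\le n-1$.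
   Context: The resistance distance $r(a,b)$ is the effective resistance between $a$ and $b$ when each edge of the graph is a unit resistor. In $L_n$ the $i$-th hexagon ($1\le i\le n$) is the cycle $p_{i-1},u_{i-1},p_i,q_i,v_{i-1},q_{i-1}$. *)

theory Defs
  imports Complex_Main
begin

text \<open>A finite simple graph is a pair of its vertex set and its set of edges, an edge being the
  two-element set of its end vertices.\<close>

type_synonym 'a graph = "'a set \<times> 'a set set"

definition neighbours :: "'a graph \<Rightarrow> 'a \<Rightarrow> 'a set" where
  "neighbours G x = {y \<in> fst G. {x, y} \<in> snd G}"

text \<open>\<open>\<phi>\<close> gives the electric potentials when one unit of current enters at \<open>a\<close> and leaves at \<open>b\<close>
  and every edge is a unit resistor. By Ohm's law the current from \<open>x\<close> to an adjacent \<open>y\<close> is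
  \<open>\<phi> x - \<phi> y\<close>; the equation is Kirchhoff's current law at \<open>x\<close>.\<close>

definition unit_current_potential :: "'a graph \<Rightarrow> 'a \<Rightarrow> 'a \<Rightarrow> ('a \<Rightarrow> real) \<Rightarrow> bool" where
  "unit_current_potential G a b \<phi> \<longleftrightarrow>
     (\<forall>x \<in> fst G. (\<Sum>y \<in> neighbours G x. \<phi> x - \<phi> y)
        = (if x = a then 1 else 0) - (if x = b then 1 else 0))"

text \<open>The effective resistance is the voltage between \<open>a\<close> and \<open>b\<close> under a unit current. It does not
  depend on the choice of \<open>\<phi>\<close> (see the lemma below); such a \<open>\<phi>\<close> exists whenever
  \<open>a\<close> and \<open>b\<close> are vertices of the same component of a finite graph.\<close>

definition resistance_distance :: "'a graph \<Rightarrow> 'a \<Rightarrow> 'a \<Rightarrow> real" where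
  "resistance_distance G a b = (THE r. \<exists>\<phi>. unit_current_potential G a b \<phi> \<and> r = \<phi> a - \<phi> b)"

lemma resistance_distance_eqI:
  assumes fin: "finite (fst G)" and a: "a \<in> fst G" and b: "b \<in> fst G"
    and phi: "unit_current_potential G a b \<phi>"
  shows "resistance_distance G a b = \<phi> a - \<phi> b"
proof -
  have pair: "(\<Sum>x\<in>fst G. \<psi> x * (\<Sum>y\<in>neighbours G x. \<chi> x - \<chi> y)) = \<psi> a - \<psi> b"
    if "unit_current_potential G a b \<chi>" for \<psi> \<chi> :: "'a \<Rightarrow> real"
  proof -
    have "(\<Sum>x\<in>fst G. \<psi> x * (\<Sum>y\<in>neighbours G x. \<chi> x - \<chi> y))
        = (\<Sum>x\<in>fst G. (if x = a then \<psi> x else 0) - (if x = b then \<psi> x else 0))"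
      using that by (intro sum.cong) (auto simp: unit_current_potential_def)
    also have "\<dots> = \<psi> a - \<psi> b"
      using fin a b by (simp add: sum_subtractf)
    finally show ?thesis .
  qed
  have expand: "(\<Sum>x\<in>fst G. \<psi> x * (\<Sum>y\<in>neighbours G x. \<chi> x - \<chi> y))
      = (\<Sum>x\<in>fst G. \<Sum>y\<in>fst G. if {x, y} \<in> snd G then \<psi> x * \<chi> x else 0)
      - (\<Sum>x\<in>fst G. \<Sum>y\<in>fst G. if {x, y} \<in> snd G then \<psi> x * \<chi> y else 0)"
    for \<psi> \<chi> :: "'a \<Rightarrow> real"
  proof -
    have "(\<Sum>x\<in>fst G. \<psi> x * (\<Sum>y\<in>neighbours G x. \<chi> x - \<chi> y))
        = (\<Sum>x\<in>fst G. \<Sum>y\<in>fst G. if {x, y} \<in> snd G then \<psi> x * (\<chi> x - \<chi> y) else 0)"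
      using fin by (simp add: neighbours_def sum_distrib_left sum.inter_filter if_distrib cong: if_cong)
    also have "\<dots> = (\<Sum>x\<in>fst G. \<Sum>y\<in>fst G. (if {x, y} \<in> snd G then \<psi> x * \<chi> x else 0)
        - (if {x, y} \<in> snd G then \<psi> x * \<chi> y else 0))"
      by (intro sum.cong) (auto simp: algebra_simps)
    finally show ?thesis by (simp add: sum_subtractf)
  qed
  have uniq: "\<psi> a - \<psi> b = \<phi> a - \<phi> b" if psi: "unit_current_potential G a b \<psi>" for \<psi>
  proof -
    have cross: "(\<Sum>x\<in>fst G. \<Sum>y\<in>fst G. if {x, y} \<in> snd G then \<psi> x * \<phi> y else 0)
        = (\<Sum>x\<in>fst G. \<Sum>y\<in>fst G. if {x, y} \<in> snd G then \<phi> x * \<psi> y else 0)"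
      by (subst sum.swap) (simp only: insert_commute mult.commute)
    have diag: "(\<Sum>x\<in>fst G. \<Sum>y\<in>fst G. if {x, y} \<in> snd G then \<psi> x * \<phi> x else 0)
        = (\<Sum>x\<in>fst G. \<Sum>y\<in>fst G. if {x, y} \<in> snd G then \<phi> x * \<psi> x else 0)"
      by (simp only: mult.commute)
    show ?thesis
      unfolding pair[OF phi, of \<psi>, symmetric] pair[OF psi, of \<phi>, symmetric]
      by (simp only: expand cross diag)
  qed
  show ?thesis
    unfolding resistance_distance_def using phi uniq by (intro the_equality) blast+
qed

datatype hex_vertex = Vp nat | Vq nat | Vu nat | Vv nat

definition hex_chain :: "nat \<Rightarrow> hex_vertex graph" where
  "hex_chain n =
    (Vp ` {0..n} \<union> Vq ` {0..n} \<union> Vu ` {0..<n} \<union> Vv ` {0..<n},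
     {{Vp i, Vq i} | i. i \<le> n} \<union>
     {{Vp i, Vu i} | i. i < n} \<union> {{Vu i, Vp (i + 1)} | i. i < n} \<union>
     {{Vq i, Vv i} | i. i < n} \<union> {{Vv i, Vq (i + 1)} | i. i < n})"

end

theory Submission
  imports Defs
begin

text \<open>Number the vertices of each of the two long paths \<open>p\<^sub>0, u\<^sub>0, p\<^sub>1, \<dots>, p\<^sub>n\<close> and
  \<open>q\<^sub>0, v\<^sub>0, q\<^sub>1, \<dots>, q\<^sub>n\<close> by \<open>0, \<dots>, 2 * n\<close>. A potential splits into a part symmetric under
  the swap of the two paths, which lives on a path with unit resistors and contributes
  \<open>\<bar>x - y\<bar> / 2\<close>, and an antisymmetric part, which lives on a path leaking with conductance \<open>2\<close>
  at the even positions. The Green's function \<open>G\<close> of the latter is explicit in hyperbolic functions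
  of integer multiples of \<open>arsinh 1\<close>, and
  \<open>r = (\<bar>x - y\<bar> + G x x + G y y \<plusminus> 2 * G x y) / 2\<close>, with sign \<open>+\<close> for vertices on opposite paths.
  As \<open>G\<close> is small, moving an end point outwards by two increases \<open>r\<close>. This gives the upper
  bounds and reduces the lower bounds to pairs at distance \<open>0\<close>, \<open>1\<close> or \<open>2\<close> along the path,
  for which \<open>r\<close> is an explicit function of the position, smallest at the centre.\<close>

section \<open>Hyperbolic functions at integer multiples of \<open>arsinh 1\<close>\<close>

text \<open>Eliminating the odd positions from the source-free equations of the leaking path leaves
  \<open>f (z + 2) + f (z - 2) = 6 * f z\<close>, with characteristic root
  \<open>3 + 2 * sqrt 2 = exp (2 * arsinh 1)\<close>. This fixes the constant
  \<open>arsinh 1\<close>.\<close>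

definition ch :: "int \<Rightarrow> real" where "ch k = cosh (of_int k * arsinh 1)"
definition sh :: "int \<Rightarrow> real" where "sh k = sinh (of_int k * arsinh 1)"

lemma ch_0 [simp]: "ch 0 = 1" and sh_0 [simp]: "sh 0 = 0"
  by (simp_all add: ch_def sh_def)

lemma sh_1 [simp]: "sh 1 = 1"
  by (simp add: sh_def)

lemma ch_1 [simp]: "ch 1 = sqrt 2"
proof -
  have "(ch 1)\<^sup>2 = 2"
    by (simp add: ch_def cosh_square_eq)
  then show ?thesis
    by (metis ch_def cosh_real_nonneg real_sqrt_unique)
qed

lemma ch_minus [simp]: "ch (- k) = ch k" and sh_minus [simp]: "sh (- k) = - sh k"
  by (simp_all add: ch_def sh_def)

lemma ch_add: "ch (a + b) = ch a * ch b + sh a * sh b"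
  and sh_add: "sh (a + b) = sh a * ch b + ch a * sh b"
  by (simp_all add: ch_def sh_def distrib_right cosh_add sinh_add)

lemma ch_diff: "ch (a - b) = ch a * ch b - sh a * sh b"
  and sh_diff: "sh (a - b) = sh a * ch b - ch a * sh b"
  using ch_add[of a "- b"] sh_add[of a "- b"] by simp_all

lemma ch_2 [simp]: "ch 2 = 3" and sh_2 [simp]: "sh 2 = 2 * sqrt 2"
  using ch_add[of 1 1] sh_add[of 1 1] by simp_all

lemma ch_3 [simp]: "ch 3 = 5 * sqrt 2"
  using ch_add[of 1 2] by simp

lemma ch_abs [simp]: "ch \<bar>k\<bar> = ch k"
  by (simp add: abs_if)

lemma arsinh_1_nonneg: "0 \<le> arsinh (1 :: real)"
  by (simp add: less_imp_le)

lemma ch_mono: "\<bar>a\<bar> \<le> \<bar>b\<bar> \<Longrightarrow> ch a \<le> ch b"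
proof -
  assume "\<bar>a\<bar> \<le> \<bar>b\<bar>"
  then have "ch \<bar>a\<bar> \<le> ch \<bar>b\<bar>"
    unfolding ch_def by (subst cosh_real_nonneg_le_iff) (auto intro!: mult_right_mono mult_nonneg_nonneg arsinh_1_nonneg)
  then show ?thesis by simp
qed

lemma ch_pos: "ch k > 0"
  by (simp add: ch_def)

lemma sh_nonneg: "k \<ge> 0 \<Longrightarrow> sh k \<ge> 0"
  by (simp add: sh_def arsinh_1_nonneg)

lemma sh_pos: "k > 0 \<Longrightarrow> sh k > 0"
  by (simp add: sh_def)

lemma sh_less_ch: "sh k < ch k"
  by (simp add: ch_def sh_def sinh_less_cosh_real)

lemma two_ch_mult: "2 * ch a * ch b = ch (a + b) + ch (a - b)"
  by (simp add: ch_add ch_diff)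

section \<open>Green's function of the leaking path\<close>

text \<open>Up to constants, \<open>wt x * ch (x + 1)\<close> is the harmonic function of the leaking path that satisfies
  the boundary condition at \<open>0\<close>; \<open>green\<close> is the usual product of this function and its mirror image.\<close>

definition wt :: "int \<Rightarrow> real" where "wt k = (if even k then 1 else sqrt 2)"

definition green :: "nat \<Rightarrow> int \<Rightarrow> int \<Rightarrow> real" where
  "green n x y = wt x * wt y * (ch (2 * int n + 2 - \<bar>x - y\<bar>) + ch (2 * int n - x - y))
     / (2 * sqrt 2 * sh (2 * int n + 2))"

lemma green_commute: "green n x y = green n y x"
  by (simp add: green_def abs_minus_commute algebra_simps)

text \<open>Away from the kink of the absolute value, both \<open>ch\<close> terms satisfy
  \<open>f (z + 1) + f (z - 1) = 2 * sqrt 2 * f z\<close>. The alternating factor \<open>wt\<close>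
  turns this constant coefficient into \<open>4\<close> at even and \<open>2\<close> at odd
  positions. The kink at \<open>z = x\<close> supplies the unit source.\<close>

lemma green_laplace:
  "(if even z then 4 else 2) * green n x z - green n x (z + 1) - green n x (z - 1)
     = (if z = x then 1 else 0)"
proof -
  define S where "S = sh (2 * int n + 2)"
  define K where "K y = ch (2 * int n + 2 - \<bar>x - y\<bar>) + ch (2 * int n - x - y)" for y
  define D where "D = 2 * sqrt 2 * S"
  have S: "S > 0" by (simp add: S_def sh_pos)
  then have D: "D > 0" by (simp add: D_def)
  have green: "green n x y = wt x * wt y * K y / D" for y
    by (simp add: green_def K_def S_def D_def)
  have nb: "ch (a + 1) + ch (a - 1) = 2 * sqrt 2 * ch a" for a
    by (simp add: ch_add ch_diff)
  have K2: "K (z + 1) + K (z - 1) = 2 * sqrt 2 * K z - (if z = x then 2 * S else 0)"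
  proof (cases z x rule: linorder_cases)
    case less
    then show ?thesis
      using nb[of "2 * int n + 2 - (x - z)"] nb[of "2 * int n - x - z"]
      by (simp add: K_def algebra_simps)
  next
    case greater
    then show ?thesis
      using nb[of "2 * int n + 2 + (x - z)"] nb[of "2 * int n - x - z"]
      by (simp add: K_def algebra_simps)
  next
    case equal
    \<comment> \<open>Both neighbours of the kink contribute this same value, so the recurrence
      falls short by \<open>2 * S\<close>. The weights contribute a further factor
      \<open>sqrt 2\<close>, which makes the defect exactly \<open>D\<close>.\<close>
    have "ch (2 * int n + 2 - 1) = sqrt 2 * ch (2 * int n + 2) - S"
      by (simp only: ch_diff S_def) simp
    then show ?thesis
      using nb[of "2 * int n - x - z"] equal
      by (simp add: K_def algebra_simps)
  qed
  show ?thesis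
  proof (cases "even z")
    case True
    then have w: "wt z = 1" "wt (z + 1) = sqrt 2" "wt (z - 1) = sqrt 2" by (simp_all add: wt_def)
    have "4 * green n x z - green n x (z + 1) - green n x (z - 1)
        = wt x * (4 * K z - sqrt 2 * (K (z + 1) + K (z - 1))) / D"
      using D by (simp only: green w) (simp add: field_simps)
    also have "\<dots> = (if z = x then 1 else 0)"
      using True S by (simp add: K2 D_def right_diff_distrib) (auto simp: wt_def)
    finally show ?thesis using True by simp
  next
    case False
    then have w: "wt z = sqrt 2" "wt (z + 1) = 1" "wt (z - 1) = 1" by (simp_all add: wt_def)
    have "2 * green n x z - green n x (z + 1) - green n x (z - 1)
        = wt x * (2 * sqrt 2 * K z - (K (z + 1) + K (z - 1))) / D"
      using D by (simp only: green w) (simp add: field_simps)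
    also have "\<dots> = (if z = x then 1 else 0)"
      using False S by (simp add: K2 D_def) (auto simp: wt_def)
    finally show ?thesis using False by simp
  qed
qed

text \<open>Position \<open>- 1\<close> acts as a fictitious neighbour of \<open>0\<close> at equal
  potential. No current flows to it, so the end of the path obeys the same equation as the
  interior.\<close>

lemma green_left_end: "x \<ge> 0 \<Longrightarrow> green n x (- 1) = green n x 0"
proof -
  assume x: "x \<ge> 0"
  have "ch (2 * int n + 2 - x) + ch (2 * int n - x) = 2 * sqrt 2 * ch (2 * int n + 1 - x)"
    using two_ch_mult[of "2 * int n + 1 - x" 1] by (simp add: algebra_simps)
  then show ?thesis using x by (simp add: green_def wt_def algebra_simps)
qed

text \<open>Mirror symmetry of the chain: reflection keeps parities, hence \<open>wt\<close>, and
  distances; \<open>2 * int n - x - y\<close> only changes sign, and \<open>ch\<close> is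
  even.\<close>

lemma green_reflect: "green n (2 * int n - x) (2 * int n - y) = green n x y"
proof -
  have "ch (x + y - 2 * int n) = ch (2 * int n - x - y)"
    using ch_minus[of "2 * int n - x - y"] by (simp add: algebra_simps)
  then show ?thesis
    by (simp add: green_def wt_def abs_minus_commute diff_diff_eq2)
qed

lemma green_right_end: "x \<le> 2 * int n \<Longrightarrow> green n x (2 * int n + 1) = green n x (2 * int n)"
  using green_left_end[of "2 * int n - x" n] green_reflect[of n x "2 * int n + 1"]
    green_reflect[of n x "2 * int n"] by simp

section \<open>Coordinates of the vertices and the resistance formula\<close>

fun pos :: "hex_vertex \<Rightarrow> int" where
  "pos (Vp i) = 2 * int i" | "pos (Vq i) = 2 * int i"
| "pos (Vu i) = 2 * int i + 1" | "pos (Vv i) = 2 * int i + 1"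

fun side :: "hex_vertex \<Rightarrow> real" where
  "side (Vp i) = 1" | "side (Vu i) = 1" | "side (Vq i) = - 1" | "side (Vv i) = - 1"

text \<open>The potential of a unit current that enters at \<open>a\<close> and leaves in equal parts at the four corners
  \<open>p\<^sub>0, q\<^sub>0, p\<^sub>n, q\<^sub>n\<close>.\<close>

definition monopole :: "nat \<Rightarrow> hex_vertex \<Rightarrow> hex_vertex \<Rightarrow> real" where
  "monopole n a v = side a * side v * green n (pos a) (pos v) / 2 - \<bar>pos v - pos a\<bar> / 4"

lemma sum_neighbours_p:
  "i \<le> n \<Longrightarrow> sum F (neighbours (hex_chain n) (Vp i)) =
     F (Vq i) + (if i < n then F (Vu i) else 0) + (if 0 < i then F (Vu (i - 1)) else (0::real))"
proof -
  assume i: "i \<le> n"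
  have "neighbours (hex_chain n) (Vp i) =
      {Vq i} \<union> (if i < n then {Vu i} else {}) \<union> (if 0 < i then {Vu (i - 1)} else {})"
    using i by (auto simp: neighbours_def hex_chain_def doubleton_eq_iff)
  then show ?thesis using i by auto
qed

lemma sum_neighbours_q:
  "i \<le> n \<Longrightarrow> sum F (neighbours (hex_chain n) (Vq i)) =
     F (Vp i) + (if i < n then F (Vv i) else 0) + (if 0 < i then F (Vv (i - 1)) else (0::real))"
proof -
  assume i: "i \<le> n"
  have "neighbours (hex_chain n) (Vq i) =
      {Vp i} \<union> (if i < n then {Vv i} else {}) \<union> (if 0 < i then {Vv (i - 1)} else {})"
    using i by (auto simp: neighbours_def hex_chain_def doubleton_eq_iff)
  then show ?thesis using i by auto
qed

lemma sum_neighbours_u: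
  "i < n \<Longrightarrow> sum F (neighbours (hex_chain n) (Vu i)) = F (Vp i) + (F (Vp (i + 1)) :: real)"
proof -
  assume i: "i < n"
  then have "neighbours (hex_chain n) (Vu i) = {Vp i, Vp (i + 1)}"
    by (auto simp: neighbours_def hex_chain_def doubleton_eq_iff)
  then show ?thesis by simp
qed

lemma sum_neighbours_v:
  "i < n \<Longrightarrow> sum F (neighbours (hex_chain n) (Vv i)) = F (Vq i) + (F (Vq (i + 1)) :: real)"
proof -
  assume i: "i < n"
  then have "neighbours (hex_chain n) (Vv i) = {Vq i, Vq (i + 1)}"
    by (auto simp: neighbours_def hex_chain_def doubleton_eq_iff)
  then show ?thesis by simp
qed

lemma pos_vertex: "a \<in> fst (hex_chain n) \<Longrightarrow> 0 \<le> pos a \<and> pos a \<le> 2 * int n"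
  by (auto simp: hex_chain_def)

text \<open>Divided by \<open>4\<close>, this second difference is the current \<open>1 / 2\<close>
  that the symmetric part injects at each of the two vertices at position \<open>x\<close>.\<close>

lemma abs_laplace: "\<bar>z + 1 - x\<bar> + \<bar>z - 1 - x\<bar> = 2 * \<bar>z - x\<bar> + (if z = x then 2 else (0::int))"
  by arith

text \<open>The symmetric part injects \<open>1 / 2\<close> at \<open>a\<close> and at its mirror
  image on the other path; the antisymmetric part injects \<open>1 / 2\<close> at \<open>a\<close>
  and \<open>- 1 / 2\<close> at the image. They add up to a unit source at \<open>a\<close> alone,
  and only the symmetric part drains at the corners.\<close>

lemma monopole_current:
  assumes n: "n \<ge> 1" and a: "a \<in> fst (hex_chain n)" and v: "v \<in> fst (hex_chain n)"
  shows "(\<Sum>y\<in>neighbours (hex_chain n) v. monopole n a v - monopole n a y)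
     = (if v = a then 1 else 0) - (if v \<in> {Vp 0, Vq 0, Vp n, Vq n} then 1 / 4 else 0)"
proof -
  define x where "x = pos a"
  define G where "G z = green n x z" for z
  define A where "A z = real_of_int \<bar>z - x\<bar>" for z
  have x: "0 \<le> x" "x \<le> 2 * int n" using pos_vertex[OF a] by (simp_all add: x_def)
  have G: "(if even z then 4 else 2) * G z - G (z + 1) - G (z - 1) = (if z = x then 1 else 0)" for z
    unfolding G_def by (rule green_laplace)
  have A: "A (z + 1) + A (z - 1) = 2 * A z + (if z = x then 2 else 0)" for z
    using arg_cong[OF abs_laplace[of z x], of real_of_int] by (simp add: A_def)
  have ends: "G (- 1) = G 0" "G (2 * int n + 1) = G (2 * int n)"
      "A (- 1) = A 0 + 1" "A (2 * int n + 1) = A (2 * int n) + 1"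
    using x green_left_end[OF x(1), of n] green_right_end[OF x(2)] by (simp_all add: G_def A_def)
  have m: "monopole n a y = side a * side y / 2 * G (pos y) - A (pos y) / 4" for y
    by (simp add: monopole_def G_def A_def x_def)
  \<comment> \<open>The factor \<open>(1 + side a * side v) / 2\<close> is \<open>1\<close> on the
    path of \<open>a\<close> and \<open>0\<close> on the other one, so it separates \<open>a\<close>
    from its mirror image.\<close>
  have delta: "(if v = a then 1 else 0) = (if pos v = x then (1 + side a * side v) / 2 else 0)" for v
    by (cases v; cases a) (auto simp: x_def, presburger+)
  \<comment> \<open>The term \<open>s * G z\<close> is the current through the rung, across which
    the symmetric parts cancel. It raises the coefficient of \<open>G z\<close> from
    \<open>2\<close> to \<open>4\<close>; odd positions have no rung.\<close>
  have even_pos: "s * G z + (s / 2 * (G z - G (z + 1)) - (A z - A (z + 1)) / 4)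
      + (s / 2 * (G z - G (z - 1)) - (A z - A (z - 1)) / 4) = (if z = x then (1 + s) / 2 else 0)"
    if "even z" for s z
  proof -
    have "s * G z + (s / 2 * (G z - G (z + 1)) - (A z - A (z + 1)) / 4)
      + (s / 2 * (G z - G (z - 1)) - (A z - A (z - 1)) / 4)
      = s / 2 * (4 * G z - G (z + 1) - G (z - 1)) + (A (z + 1) + A (z - 1) - 2 * A z) / 4"
      by (simp add: field_simps)
    then show ?thesis using that G[of z] A[of z] by (simp add: add_divide_distrib)
  qed
  have odd_pos: "(s / 2 * (G z - G (z + 1)) - (A z - A (z + 1)) / 4)
      + (s / 2 * (G z - G (z - 1)) - (A z - A (z - 1)) / 4) = (if z = x then (1 + s) / 2 else 0)"
    if "odd z" for s z
  proof -
    have "(s / 2 * (G z - G (z + 1)) - (A z - A (z + 1)) / 4)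
      + (s / 2 * (G z - G (z - 1)) - (A z - A (z - 1)) / 4)
      = s / 2 * (2 * G z - G (z + 1) - G (z - 1)) + (A (z + 1) + A (z - 1) - 2 * A z) / 4"
      by (simp add: field_simps)
    then show ?thesis using that G[of z] A[of z] by (simp add: add_divide_distrib)
  qed
  \<comment> \<open>The edge missing at \<open>i = n\<close> is added as an edge to a fictitious
    position. There \<open>G\<close> drives no current and \<open>A\<close> contributes
    \<open>1 / 4\<close>, which is subtracted again as the outflow at the corner.\<close>
  have up: "(if i < n then s / 2 * (G (2 * int i) - G (2 * int i + 1))
        - (A (2 * int i) - A (2 * int i + 1)) / 4 else 0)
      = s / 2 * (G (2 * int i) - G (2 * int i + 1)) - (A (2 * int i) - A (2 * int i + 1)) / 4
        - (if i = n then 1 / 4 else 0)" if "i \<le> n" for i s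
    using that ends by (cases "i = n") auto
  have down: "(if 0 < i then s / 2 * (G (2 * int i) - G (2 * int i - 1))
        - (A (2 * int i) - A (2 * int i - 1)) / 4 else 0)
      = s / 2 * (G (2 * int i) - G (2 * int i - 1)) - (A (2 * int i) - A (2 * int i - 1)) / 4
        - (if i = 0 then 1 / 4 else 0)" for i s
    using ends by (cases "i = 0") auto
  have pred: "2 * int (i - 1) + 1 = 2 * int i - 1" if "0 < i" for i
    using that by (simp add: of_nat_diff)
  consider i where "v = Vp i" "i \<le> n" | i where "v = Vq i" "i \<le> n"
    | i where "v = Vu i" "i < n" | i where "v = Vv i" "i < n"
    using v by (auto simp: hex_chain_def)
  then show ?thesis
  proof cases
    case 1
    have "(\<Sum>y\<in>neighbours (hex_chain n) v. monopole n a v - monopole n a y) =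
        side a * G (2 * int i)
        + (if i < n then side a / 2 * (G (2 * int i) - G (2 * int i + 1))
            - (A (2 * int i) - A (2 * int i + 1)) / 4 else 0)
        + (if 0 < i then side a / 2 * (G (2 * int i) - G (2 * int i - 1))
            - (A (2 * int i) - A (2 * int i - 1)) / 4 else 0)"
      unfolding 1(1) sum_neighbours_p[OF 1(2)]
      using n by (cases "i < n"; cases "0 < i") (simp_all add: m pred, simp_all add: field_simps)
    moreover have "(if v = a then 1 else 0) = (if 2 * int i = x then (1 + side a) / 2 else 0)"
      by (simp add: delta 1)
    moreover have "(if v \<in> {Vp 0, Vq 0, Vp n, Vq n} then 1 / 4 else 0)
        = (if i = n then 1 / 4 else 0) + (if i = 0 then 1 / 4 else (0::real))"
      using n by (auto simp: 1)
    moreover note up[OF 1(2), of "side a"] down[of i "side a"] even_pos[of "2 * int i" "side a", OF dvd_triv_left]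
    ultimately show ?thesis by linarith
  next
    case 2
    have "(\<Sum>y\<in>neighbours (hex_chain n) v. monopole n a v - monopole n a y) =
        - side a * G (2 * int i)
        + (if i < n then - side a / 2 * (G (2 * int i) - G (2 * int i + 1))
            - (A (2 * int i) - A (2 * int i + 1)) / 4 else 0)
        + (if 0 < i then - side a / 2 * (G (2 * int i) - G (2 * int i - 1))
            - (A (2 * int i) - A (2 * int i - 1)) / 4 else 0)"
      unfolding 2(1) sum_neighbours_q[OF 2(2)]
      using n by (cases "i < n"; cases "0 < i") (simp_all add: m pred, simp_all add: field_simps)
    moreover have "(if v = a then 1 else 0) = (if 2 * int i = x then (1 + - side a) / 2 else 0)"
      by (simp add: delta 2)
    moreover have "(if v \<in> {Vp 0, Vq 0, Vp n, Vq n} then 1 / 4 else 0)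
        = (if i = n then 1 / 4 else 0) + (if i = 0 then 1 / 4 else (0::real))"
      using n by (auto simp: 2)
    moreover note up[OF 2(2), of "- side a"] down[of i "- side a"] even_pos[of "2 * int i" "- side a", OF dvd_triv_left]
    ultimately show ?thesis by linarith
  next
    case 3
    have "(\<Sum>y\<in>neighbours (hex_chain n) v. monopole n a v - monopole n a y) =
        (side a / 2 * (G (2 * int i + 1) - G (2 * int i + 1 + 1))
            - (A (2 * int i + 1) - A (2 * int i + 1 + 1)) / 4)
        + (side a / 2 * (G (2 * int i + 1) - G (2 * int i + 1 - 1))
            - (A (2 * int i + 1) - A (2 * int i + 1 - 1)) / 4)"
      unfolding 3(1) sum_neighbours_u[OF 3(2)] m by (simp add: field_simps)
    then show ?thesis
      unfolding delta using odd_pos[of "2 * int i + 1" "side a"] by (simp add: 3)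
  next
    case 4
    have "(\<Sum>y\<in>neighbours (hex_chain n) v. monopole n a v - monopole n a y) =
        (- side a / 2 * (G (2 * int i + 1) - G (2 * int i + 1 + 1))
            - (A (2 * int i + 1) - A (2 * int i + 1 + 1)) / 4)
        + (- side a / 2 * (G (2 * int i + 1) - G (2 * int i + 1 - 1))
            - (A (2 * int i + 1) - A (2 * int i + 1 - 1)) / 4)"
      unfolding 4(1) sum_neighbours_v[OF 4(2)] m by (simp add: field_simps)
    then show ?thesis
      unfolding delta using odd_pos[of "2 * int i + 1" "- side a"] by (simp add: 4)
  qed
qed

definition res :: "nat \<Rightarrow> real \<Rightarrow> int \<Rightarrow> int \<Rightarrow> real" where
  "res n s x y = (\<bar>y - x\<bar> + green n x x + green n y y + 2 * s * green n x y) / 2"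

text \<open>In the difference of the monopoles at \<open>a\<close> and \<open>b\<close> the drains
  at the four corners cancel, which leaves a unit current from \<open>a\<close> to
  \<open>b\<close>.\<close>

lemma resistance_distance_hex_chain:
  assumes n: "n \<ge> 1" and a: "a \<in> fst (hex_chain n)" and b: "b \<in> fst (hex_chain n)"
  shows "resistance_distance (hex_chain n) a b = res n (- side a * side b) (pos a) (pos b)"
proof -
  define \<phi> where "\<phi> v = monopole n a v - monopole n b v" for v
  have "(\<Sum>y\<in>neighbours (hex_chain n) x. \<phi> x - \<phi> y)
      = (\<Sum>y\<in>neighbours (hex_chain n) x. monopole n a x - monopole n a y)
      - (\<Sum>y\<in>neighbours (hex_chain n) x. monopole n b x - monopole n b y)" for x
    unfolding sum_subtractf[symmetric] by (intro sum.cong) (simp_all add: \<phi>_def)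
  then have "unit_current_potential (hex_chain n) a b \<phi>"
    using monopole_current[OF n a] monopole_current[OF n b] by (simp add: unit_current_potential_def)
  moreover have "finite (fst (hex_chain n))" by (simp add: hex_chain_def)
  ultimately have "resistance_distance (hex_chain n) a b = \<phi> a - \<phi> b"
    using resistance_distance_eqI[OF _ a b] by blast
  moreover have "side a * side a = 1" "side b * side b = 1" by (cases a; simp) (cases b; simp)
  ultimately show ?thesis
    by (simp add: \<phi>_def monopole_def res_def green_commute[of n "pos b" "pos a"]
        abs_minus_commute[of "real_of_int (pos b)"] field_simps)
qed

section \<open>Size of the Green's function and monotonicity of the resistance\<close>

lemma sqrt_2_mult_sqrt_2 [simp]: "sqrt 2 * (sqrt 2 * x) = 2 * x"
  by (simp flip: mult.assoc)

lemma sqrt_2_bounds: "1 \<le> sqrt 2" "sqrt 2 < 2"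
  by (simp, rule real_less_lsqrt) auto

text \<open>The constants are chosen so that
  \<open>2 + green n (y + 2) (y + 2) - 3 * green n y y\<close> is nonnegative for either parity. For
  the upper bounds, \<open>ch (N - 2 - 2 * y)\<close> is largest at the outermost position of the
  given parity.\<close>

lemma green_diag_bounds:
  assumes y: "0 \<le> y" "y \<le> 2 * int n" and n: "n \<ge> 1"
  shows "even y \<Longrightarrow> 0 \<le> green n y y" "even y \<Longrightarrow> green n y y \<le> 1 / 2"
    and "odd y \<Longrightarrow> 1 / 2 \<le> green n y y" "odd y \<Longrightarrow> green n y y \<le> 3 / 4"
proof -
  define N where "N = 2 * int n + 2"
  have N: "N \<ge> 4" using n by (simp add: N_def)
  have S: "sh N > 0" using N by (simp add: sh_pos)
  have green: "green n y y = (wt y)\<^sup>2 * (ch N + ch (N - 2 - 2 * y)) / (2 * sqrt 2 * sh N)"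
    by (simp add: green_def N_def power2_eq_square)
  note pos = ch_pos[of N] ch_pos[of "N - 2 - 2 * y"]
  show "even y \<Longrightarrow> 0 \<le> green n y y"
    using S pos by (simp add: green wt_def less_imp_le)
  show "odd y \<Longrightarrow> 1 / 2 \<le> green n y y"
  proof -
    assume "odd y"
    then have "green n y y = (ch N + ch (N - 2 - 2 * y)) / (sqrt 2 * sh N)"
      using S by (simp add: green wt_def field_simps)
    moreover have "sqrt 2 * sh N \<le> 2 * ch N"
      using sqrt_2_bounds sh_less_ch[of N] S by (intro mult_mono) auto
    ultimately show ?thesis using S pos by (simp add: pos_le_divide_eq)
  qed
  show "even y \<Longrightarrow> green n y y \<le> 1 / 2"
  proof -
    assume "even y"
    then have g: "green n y y = (ch N + ch (N - 2 - 2 * y)) / (2 * sqrt 2 * sh N)"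
      by (simp add: green wt_def)
    have "ch (N - 2 - 2 * y) \<le> ch (N - 2)"
      using y by (intro ch_mono) (auto simp: N_def)
    moreover have "ch N + ch (N - 2) = 2 * sqrt 2 * ch (N - 1)"
      using two_ch_mult[of "N - 1" 1] by (simp add: algebra_simps)
    \<comment> \<open>The difference of the two sides is \<open>sh (N - 2)\<close>.\<close>
    moreover have "2 * ch (N - 1) \<le> sh N"
    proof -
      have "sh (N - 2) \<ge> 0" using N by (simp add: sh_nonneg)
      then have "sqrt 2 * (sqrt 2 * sh (N - 1)) \<ge> sqrt 2 * ch (N - 1)"
        using sh_diff[of "N - 1" 1] by (intro mult_left_mono) (simp_all add: algebra_simps)
      moreover have "sh N = sqrt 2 * sh (N - 1) + ch (N - 1)"
        using sh_add[of "N - 1" 1] by simp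
      ultimately show ?thesis
        using \<open>sh (N - 2) \<ge> 0\<close> sh_diff[of "N - 1" 1] by (simp add: algebra_simps)
    qed
    moreover have "sqrt 2 * (2 * ch (N - 1)) \<le> sqrt 2 * sh N"
      using calculation(3) by (intro mult_left_mono) auto
    ultimately have "ch N + ch (N - 2 - 2 * y) \<le> sqrt 2 * sh N" by linarith
    then show ?thesis using S by (simp add: g pos_divide_le_eq)
  qed
  show "odd y \<Longrightarrow> green n y y \<le> 3 / 4"
  proof -
    assume odd: "odd y"
    then have g: "green n y y = (ch N + ch (N - 2 - 2 * y)) / (sqrt 2 * sh N)"
      using S by (simp add: green wt_def field_simps)
    have "1 \<le> y" "y \<le> 2 * int n - 1" using y odd by presburger+
    then have "ch (N - 2 - 2 * y) \<le> ch (N - 4)"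
      by (intro ch_mono) (auto simp: N_def)
    moreover have "ch N + ch (N - 4) = 6 * ch (N - 2)"
      using two_ch_mult[of "N - 2" 2] by (simp add: algebra_simps)
    \<comment> \<open>The difference of the two sides is \<open>sh (N - 4)\<close>, and
      \<open>N \<ge> 4\<close>.\<close>
    moreover have "4 * sqrt 2 * ch (N - 2) \<le> sh N"
    proof -
      have "sh (N - 4) \<ge> 0" using N by (simp add: sh_nonneg)
      then show ?thesis
        using sh_diff[of "N - 2" 2] sh_add[of "N - 2" 2] by (simp add: algebra_simps)
    qed
    moreover have "sqrt 2 * (4 * sqrt 2 * ch (N - 2)) \<le> sqrt 2 * sh N"
      using calculation(3) by (intro mult_left_mono) auto
    ultimately have "ch N + ch (N - 2 - 2 * y) \<le> 3 / 4 * (sqrt 2 * sh N)" by (simp add: algebra_simps)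
    then show ?thesis using S by (simp add: g pos_divide_le_eq)
  qed
qed

text \<open>Fixing the order of the arguments removes the absolute value, and the product formula
  for \<open>ch\<close> separates the variables. Monotonicity in one argument then concerns one
  factor only.\<close>

lemma green_le:
  assumes "0 \<le> x" "x \<le> y"
  shows "green n x y = wt x * ch (x + 1) * (wt y * ch (2 * int n + 1 - y)) / (sqrt 2 * sh (2 * int n + 2))"
proof -
  have "ch (2 * int n + 2 - \<bar>x - y\<bar>) + ch (2 * int n - x - y) = 2 * (ch (x + 1) * ch (2 * int n + 1 - y))"
    using assms two_ch_mult[of "2 * int n + 1 - y" "x + 1"] by (simp add: algebra_simps)
  then show ?thesis by (simp add: green_def)
qed

lemma green_antimono:
  assumes "0 \<le> x" "x \<le> y" "y + 2 \<le> 2 * int n"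
  shows "green n x (y + 2) \<le> green n x y"
proof -
  have "wt (y + 2) = wt y" by (simp add: wt_def)
  moreover have "ch (2 * int n + 1 - (y + 2)) \<le> ch (2 * int n + 1 - y)"
    using assms by (intro ch_mono) auto
  moreover have "sh (2 * int n + 2) > 0" by (simp add: sh_pos)
  moreover have "wt x \<ge> 0" "wt y \<ge> 0" by (simp_all add: wt_def)
  ultimately show ?thesis
    using assms ch_pos[of "x + 1"]
    by (simp add: green_le) (intro divide_right_mono mult_left_mono mult_nonneg_nonneg; simp)
qed

lemma green_nonneg:
  assumes "0 \<le> x" "x \<le> y"
  shows "0 \<le> green n x y"
proof -
  have "sh (2 * int n + 2) > 0" by (simp add: sh_pos)
  moreover have "wt x \<ge> 0" "wt y \<ge> 0" by (simp_all add: wt_def)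
  ultimately show ?thesis
    using assms ch_pos[of "x + 1"] ch_pos[of "2 * int n + 1 - y"] by (simp add: green_le)
qed

text \<open>The weight may drop from \<open>sqrt 2\<close> to \<open>1\<close> between
  \<open>x\<close> and \<open>y\<close>, but one step already makes up for it:
  \<open>ch (x + 2) = sqrt 2 * ch (x + 1) + sh (x + 1)\<close>.\<close>

lemma green_le_diag:
  assumes "0 \<le> x" "x \<le> y"
  shows "green n x y \<le> green n y y"
proof -
  have "wt x * ch (x + 1) \<le> wt y * ch (y + 1)"
  proof (cases "x = y")
    case False
    have "wt x * ch (x + 1) \<le> sqrt 2 * ch (x + 1)"
      using sqrt_2_bounds ch_pos[of "x + 1"] by (intro mult_right_mono) (auto simp: wt_def)
    also have "\<dots> \<le> ch (x + 2)"
      using ch_add[of "x + 1" 1] sh_nonneg[of "x + 1"] assms by (simp add: algebra_simps)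
    also have "\<dots> \<le> ch (y + 1)"
      using assms False by (intro ch_mono) auto
    also have "\<dots> \<le> wt y * ch (y + 1)"
      using sqrt_2_bounds ch_pos[of "y + 1"] by (auto simp: wt_def)
    finally show ?thesis .
  qed simp
  moreover have "sh (2 * int n + 2) > 0" by (simp add: sh_pos)
  moreover have "wt y \<ge> 0" by (simp add: wt_def)
  ultimately show ?thesis
    using assms ch_pos[of "2 * int n + 1 - y"]
    by (simp add: green_le) (intro divide_right_mono mult_right_mono mult_nonneg_nonneg; simp)
qed

text \<open>The path term gains \<open>2\<close> before halving. The mixed term loses at most
  \<open>2 * green n y y\<close>, because \<open>green n x (y + 2)\<close> and
  \<open>green n x y\<close> both lie between \<open>0\<close> and \<open>green n y y\<close>; the
  diagonal bounds cover this loss.\<close>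

lemma res_step:
  assumes n: "n \<ge> 1" and s: "s = 1 \<or> s = - 1" and xy: "0 \<le> x" "x \<le> y" "y + 2 \<le> 2 * int n"
  shows "res n s x y \<le> res n s x (y + 2)"
proof -
  have "2 + green n (y + 2) (y + 2) - 3 * green n y y \<ge> 0"
    using green_diag_bounds[of y n] green_diag_bounds[of "y + 2" n] n xy by (cases "even y") auto
  moreover have "s * (green n x (y + 2) - green n x y) \<ge> - green n y y"
    using s green_antimono[OF xy] green_le_diag[OF xy(1,2), of n]
      green_nonneg[of x "y + 2" n] green_nonneg[of y y n] xy by auto
  moreover have "green n y y \<ge> 0" using xy green_nonneg[of y y n] by auto
  moreover have "real_of_int \<bar>y + 2 - x\<bar> = real_of_int \<bar>y - x\<bar> + 2" using xy by simp
  ultimately show ?thesis by (simp add: res_def field_simps)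
qed

lemma res_reflect: "res n s (2 * int n - y) (2 * int n - x) = res n s x y"
  by (simp add: res_def green_reflect green_commute[of n y x])

lemma res_mono_right:
  assumes n: "n \<ge> 1" and s: "s = 1 \<or> s = - 1"
    and xy: "0 \<le> x" "x \<le> y" "y \<le> y'" "y' \<le> 2 * int n" "even (y' - y)"
  shows "res n s x y \<le> res n s x y'"
proof -
  have "y + 2 * int k \<le> 2 * int n \<Longrightarrow> res n s x y \<le> res n s x (y + 2 * int k)" for k
  proof (induction k)
    case (Suc k)
    then show ?case
      using res_step[OF n s xy(1), of "y + 2 * int k"] xy by (simp add: algebra_simps)
  qed simp
  moreover obtain k where "y' - y = 2 * int k"
    using xy by (metis diff_ge_0_iff_ge evenE nonneg_int_cases zero_le_mult_iff zero_less_numeral not_le)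
  ultimately show ?thesis using xy by (metis add.commute diff_add_cancel)
qed

text \<open>The right end is moved first; reflection turns the move of the left end into another
  move to the right.\<close>

lemma res_mono:
  assumes n: "n \<ge> 1" and s: "s = 1 \<or> s = - 1"
    and xy: "0 \<le> x'" "x' \<le> x" "x \<le> y" "y \<le> y'" "y' \<le> 2 * int n" "even (x - x')" "even (y' - y)"
  shows "res n s x y \<le> res n s x' y'"
proof -
  have "res n s x y \<le> res n s x y'"
    using assms by (intro res_mono_right) auto
  also have "\<dots> = res n s (2 * int n - y') (2 * int n - x)"
    by (simp add: res_reflect)
  also have "\<dots> \<le> res n s (2 * int n - y') (2 * int n - x')"
    using assms by (intro res_mono_right) auto
  also have "\<dots> = res n s x' y'"
    by (simp add: res_reflect)
  finally show ?thesis .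
qed

section \<open>Closest pairs: explicit resistance and its minimum over the position\<close>

lemma res_0: "res n 1 x x = (wt x)\<^sup>2 * (ch (2 * int n + 2) + ch (2 * int n - 2 * x))
    / (sqrt 2 * sh (2 * int n + 2))"
  using sh_pos[of "2 * int n + 2"] by (simp add: res_def green_def power2_eq_square field_simps)

lemma res_2: "res n (- 1) x (x + 2) = 1 + (wt x)\<^sup>2 *
    (ch (2 * int n + 2) - ch (2 * int n) + 2 * ch (2 * int n - 2 * x - 2)) / (2 * sqrt 2 * sh (2 * int n + 2))"
proof -
  define D where "D = 2 * sqrt 2 * sh (2 * int n + 2)"
  \<comment> \<open>Here \<open>6 = 2 * ch 2\<close>. This gathers the dependence on the position in
    one term, centred at the midpoint \<open>x + 1\<close> of the pair.\<close>
  have "ch (2 * int n - 2 * x - 4) = 6 * ch (2 * int n - 2 * x - 2) - ch (2 * int n - 2 * x)"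
    using two_ch_mult[of "2 * int n - 2 * x - 2" 2] by (simp add: algebra_simps)
  then have "green n (x + 2) (x + 2) = (wt x)\<^sup>2 * (ch (2 * int n + 2)
      + (6 * ch (2 * int n - 2 * x - 2) - ch (2 * int n - 2 * x))) / D"
    by (simp add: green_def D_def wt_def power2_eq_square algebra_simps)
  moreover have "green n x x = (wt x)\<^sup>2 * (ch (2 * int n + 2) + ch (2 * int n - 2 * x)) / D"
    "green n x (x + 2) = (wt x)\<^sup>2 * (ch (2 * int n) + ch (2 * int n - 2 * x - 2)) / D"
    by (simp_all add: green_def D_def wt_def power2_eq_square algebra_simps)
  ultimately show ?thesis
    unfolding D_def[symmetric]
    by (simp add: res_def add_divide_distrib diff_divide_distrib algebra_simps)
qed

text \<open>The end points have different weights, so besides the \<open>ch\<close> term a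
  \<open>sh\<close> term in the midpoint variable \<open>2 * int n - 2 * x - 1\<close> survives, and
  the position dependence is not symmetric about the centre.\<close>

lemma res_1: "even x \<Longrightarrow> res n s x (x + 1) = 1 / 2 +
    (3 * ch (2 * int n + 2) + 2 * s * sqrt 2 * ch (2 * int n + 1)
      + (3 + 2 * s) * sqrt 2 * ch (2 * int n - 2 * x - 1) - sh (2 * int n - 2 * x - 1))
    / (4 * sqrt 2 * sh (2 * int n + 2))"
proof -
  assume x: "even x"
  define D where "D = 2 * sqrt 2 * sh (2 * int n + 2)"
  define z where "z = 2 * int n - 2 * x - 1"
  have "ch (2 * int n - 2 * x) = sqrt 2 * ch z + sh z"
    "ch (2 * int n - 2 * x - 2) = sqrt 2 * ch z - sh z"
    using ch_add[of z 1] ch_diff[of z 1] by (simp_all add: z_def algebra_simps)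
  then have diag: "green n x x = (ch (2 * int n + 2) + (sqrt 2 * ch z + sh z)) / D"
    "green n (x + 1) (x + 1) = 2 * (ch (2 * int n + 2) + (sqrt 2 * ch z - sh z)) / D"
    using x by (simp_all add: green_def D_def wt_def algebra_simps)
  have off_diag: "green n x (x + 1) = sqrt 2 * (ch (2 * int n + 1) + ch z) / D"
    using x by (simp add: green_def D_def wt_def z_def algebra_simps)
  have D4: "4 * sqrt 2 * sh (2 * int n + 2) = 2 * D" by (simp add: D_def)
  show ?thesis
    unfolding z_def[symmetric] D4 res_def diag off_diag
    by (simp add: add_divide_distrib diff_divide_distrib algebra_simps)
qed

lemma res_0_le:
  assumes "even x' = even x" "\<bar>int n - x'\<bar> \<le> \<bar>int n - x\<bar>"
  shows "res n 1 x' x' \<le> res n 1 x x"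
proof -
  have "ch (2 * int n - 2 * x') \<le> ch (2 * int n - 2 * x)"
    using assms by (intro ch_mono) auto
  moreover have "wt x' = wt x" using assms by (simp add: wt_def)
  ultimately show ?thesis
    using sh_pos[of "2 * int n + 2"] by (simp add: res_0 divide_right_mono mult_left_mono)
qed

lemma res_2_le:
  assumes "even x' = even x" "\<bar>int n - x' - 1\<bar> \<le> \<bar>int n - x - 1\<bar>"
  shows "res n (- 1) x' (x' + 2) \<le> res n (- 1) x (x + 2)"
proof -
  have "ch (2 * int n - 2 * x' - 2) \<le> ch (2 * int n - 2 * x - 2)"
    using assms by (intro ch_mono) auto
  moreover have "wt x' = wt x" using assms by (simp add: wt_def)
  ultimately show ?thesis
    using sh_pos[of "2 * int n + 2"] by (simp add: res_2 divide_right_mono mult_left_mono)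
qed

text \<open>Only \<open>g z\<close> depends on the position, and \<open>z\<close> runs through a
  single residue class modulo \<open>4\<close>. The choice \<open>n div 2\<close> gives its
  representative \<open>1\<close> or \<open>- 1\<close>; every other one has absolute value at least
  \<open>3\<close>.\<close>

lemma res_1_le:
  assumes s: "s = 1 \<or> s = - 1"
  shows "res n s (2 * int (n div 2)) (2 * int (n div 2) + 1) \<le> res n s (2 * int j) (2 * int j + 1)"
proof -
  define g where "g z = (3 + 2 * s) * sqrt 2 * ch z - sh z" for z
  define z where "z = 2 * int n - 4 * int j - 1"
  define z' where "z' = 2 * int n - 4 * int (n div 2) - 1"
  have z': "z' = 1 \<or> z' = - 1" unfolding z'_def by presburger
  have zz': "4 dvd z - z'" unfolding z_def z'_def by presburger
  have "g z' \<le> g z"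
  proof (cases "z = z'")
    case False
    have z: "\<bar>z\<bar> \<ge> 3" "\<bar>z' - 1\<bar> \<le> \<bar>z - 1\<bar>" using z' zz' False by presburger+
    from s show ?thesis
    proof
      assume s: "s = - 1"
      have "g w = ch (w - 1)" for w by (simp add: g_def s ch_diff)
      then show ?thesis using z(2) by (simp add: ch_mono)
    next
      assume s: "s = 1"
      \<comment> \<open>The values of \<open>g\<close> at \<open>1\<close> and \<open>- 1\<close>
        are \<open>9\<close> and \<open>11\<close>. A crude bound suffices, since
        \<open>ch 3 = 5 * sqrt 2\<close> already puts \<open>g z\<close> far above them.\<close>
      have "g z' \<le> 11" using z' by (auto simp: g_def s mult.assoc)
      also have "\<dots> \<le> (5 * sqrt 2 - 1) * (5 * sqrt 2)"
        using sqrt_2_bounds by (simp add: algebra_simps)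
      also have "\<dots> \<le> (5 * sqrt 2 - 1) * ch z"
      proof (rule mult_left_mono)
        show "0 \<le> 5 * sqrt 2 - 1" using sqrt_2_bounds(1) by linarith
      qed (use ch_mono[of 3 z] z(1) in simp)
      also have "\<dots> \<le> g z" using sh_less_ch[of z] by (simp add: g_def s algebra_simps)
      finally show ?thesis .
    qed
  qed simp
  then show ?thesis
    using sh_pos[of "2 * int n + 2"]
    by (simp add: res_1 g_def z_def z'_def divide_right_mono)
qed

section \<open>Extremal pairs for the six combinations of vertex types\<close>

theorem theorem3p4:
  fixes n :: nat and r :: "hex_vertex \<Rightarrow> hex_vertex \<Rightarrow> real"
  assumes n: "n \<ge> 1"
    and r: "r = resistance_distance (hex_chain n)"
  shows
    "(\<forall>j i. j < i \<and> i \<le> n \<longrightarrow>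
        r (Vp 0) (Vp n) \<ge> r (Vp j) (Vp i) \<and>
        r (Vp j) (Vp i) \<ge> r (Vp ((n - 1) div 2)) (Vp ((n - 1) div 2 + 1))) \<and>
     (\<forall>j i. j \<le> i \<and> i \<le> n \<longrightarrow>
        r (Vq 0) (Vp n) \<ge> r (Vq j) (Vp i) \<and>
        r (Vq j) (Vp i) \<ge> r (Vq (n div 2)) (Vp (n div 2))) \<and>
     (\<forall>j i. j < i \<and> i \<le> n - 1 \<longrightarrow>
        r (Vu 0) (Vu (n - 1)) \<ge> r (Vu j) (Vu i) \<and>
        r (Vu j) (Vu i) \<ge> r (Vu ((n - 1) div 2)) (Vu ((n - 1) div 2 + 1))) \<and>
     (\<forall>j i. j \<le> i \<and> i \<le> n - 1 \<longrightarrow>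
        r (Vv 0) (Vu (n - 1)) \<ge> r (Vv j) (Vu i) \<and>
        r (Vv j) (Vu i) \<ge> r (Vv (n div 2)) (Vu (n div 2))) \<and>
     (\<forall>j i. j \<le> i \<and> i \<le> n - 1 \<longrightarrow>
        r (Vp 0) (Vu (n - 1)) \<ge> r (Vp j) (Vu i) \<and>
        r (Vp j) (Vu i) \<ge> r (Vp (n div 2)) (Vu (n div 2))) \<and>
     (\<forall>j i. j \<le> i \<and> i \<le> n - 1 \<longrightarrow>
        r (Vp 0) (Vv (n - 1)) \<ge> r (Vp j) (Vv i) \<and>
        r (Vp j) (Vv i) \<ge> r (Vp (n div 2)) (Vv (n div 2)))"
proof -
  have even_vertex: "Vp i \<in> fst (hex_chain n)" "Vq i \<in> fst (hex_chain n)" if "i \<le> n" for i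
    using that by (auto simp: hex_chain_def)
  have odd_vertex: "Vu i \<in> fst (hex_chain n)" "Vv i \<in> fst (hex_chain n)" if "i < n" for i
    using that by (auto simp: hex_chain_def)
  note R = resistance_distance_hex_chain[OF n, folded r]
  have pp: "r (Vp j) (Vp i) = res n (- 1) (2 * int j) (2 * int i)"
    and qp: "r (Vq j) (Vp i) = res n 1 (2 * int j) (2 * int i)" if "j \<le> n" "i \<le> n" for i j
    using that by (simp_all add: R even_vertex)
  have uu: "r (Vu j) (Vu i) = res n (- 1) (2 * int j + 1) (2 * int i + 1)"
    and vu: "r (Vv j) (Vu i) = res n 1 (2 * int j + 1) (2 * int i + 1)" if "j < n" "i < n" for i j
    using that by (simp_all add: R odd_vertex)
  have pu: "r (Vp j) (Vu i) = res n (- 1) (2 * int j) (2 * int i + 1)"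
    and pv: "r (Vp j) (Vv i) = res n 1 (2 * int j) (2 * int i + 1)" if "j \<le> n" "i < n" for i j
    using that by (simp_all add: R even_vertex odd_vertex)
  note mono = res_mono[OF n, of "- 1"] res_mono[OF n, of 1]
  have pred: "int (n - 1) = int n - 1" using n by (simp add: of_nat_diff)
  have below: "i < n" if "i \<le> n - 1" for i using that n by simp
  have half: "n div 2 < n" "(n - 1) div 2 + 1 \<le> n" using n by presburger+
  show ?thesis
  proof (intro conjI allI impI; elim conjE)
    fix j i assume *: "j < i" "i \<le> n"
    then show "r (Vp j) (Vp i) \<le> r (Vp 0) (Vp n)"
      by (simp add: pp mono)
    \<comment> \<open>As in the other five cases, the pair is first shrunk to the shortest
      admissible distance, here \<open>2\<close>, and then slid to the position of its parity
      nearest the centre.\<close>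
    have "res n (- 1) (2 * int ((n - 1) div 2)) (2 * int ((n - 1) div 2) + 2)
        \<le> res n (- 1) (2 * int j) (2 * int j + 2)"
      using n by (intro res_2_le; simp; presburger)
    also have "\<dots> \<le> res n (- 1) (2 * int j) (2 * int i)"
      using * by (intro mono) auto
    finally show "r (Vp ((n - 1) div 2)) (Vp ((n - 1) div 2 + 1)) \<le> r (Vp j) (Vp i)"
      using * half by (simp add: pp algebra_simps)
  next
    fix j i assume *: "j \<le> i" "i \<le> n"
    then show "r (Vq j) (Vp i) \<le> r (Vq 0) (Vp n)"
      by (simp add: qp mono)
    have "res n 1 (2 * int (n div 2)) (2 * int (n div 2)) \<le> res n 1 (2 * int j) (2 * int j)"
      by (intro res_0_le; simp; presburger)
    also have "\<dots> \<le> res n 1 (2 * int j) (2 * int i)"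
      using * by (intro mono) auto
    finally show "r (Vq (n div 2)) (Vp (n div 2)) \<le> r (Vq j) (Vp i)"
      using * by (simp add: qp)
  next
    fix j i assume *: "j < i" "i \<le> n - 1"
    then show "r (Vu j) (Vu i) \<le> r (Vu 0) (Vu (n - 1))"
      using n by (simp add: uu pred) (intro mono; simp)
    have "res n (- 1) (2 * int ((n - 1) div 2) + 1) (2 * int ((n - 1) div 2) + 1 + 2)
        \<le> res n (- 1) (2 * int j + 1) (2 * int j + 1 + 2)"
      using n by (intro res_2_le; simp; presburger)
    also have "\<dots> \<le> res n (- 1) (2 * int j + 1) (2 * int i + 1)"
      using * by (intro mono) auto
    finally have "res n (- 1) (2 * int ((n - 1) div 2) + 1) (2 * int ((n - 1) div 2) + 1 + 2)
        \<le> res n (- 1) (2 * int j + 1) (2 * int i + 1)" .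
    \<comment> \<open>The existence of \<open>j < i \<le> n - 1\<close> forces
      \<open>n \<ge> 2\<close>, so the second vertex of the minimal pair lies in the chain.\<close>
    moreover have "(n - 1) div 2 + 1 < n" using * by presburger
    ultimately show "r (Vu ((n - 1) div 2)) (Vu ((n - 1) div 2 + 1)) \<le> r (Vu j) (Vu i)"
      using * by (simp add: uu algebra_simps)
  next
    fix j i assume *: "j \<le> i" "i \<le> n - 1"
    then have "i < n" "j < n" using n by simp_all
    then show "r (Vv j) (Vu i) \<le> r (Vv 0) (Vu (n - 1))"
      using n * by (simp add: vu pred) (intro mono; simp)
    have "res n 1 (2 * int (n div 2) + 1) (2 * int (n div 2) + 1) \<le> res n 1 (2 * int j + 1) (2 * int j + 1)"
      by (intro res_0_le; simp; presburger)
    also have "\<dots> \<le> res n 1 (2 * int j + 1) (2 * int i + 1)"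
      using * n by (intro mono) auto
    finally show "r (Vv (n div 2)) (Vu (n div 2)) \<le> r (Vv j) (Vu i)"
      using \<open>i < n\<close> \<open>j < n\<close> half by (simp add: vu)
  next
    fix j i assume *: "j \<le> i" "i \<le> n - 1"
    then have "i < n" "j < n" using n by simp_all
    then show "r (Vp j) (Vu i) \<le> r (Vp 0) (Vu (n - 1))"
      using n * by (simp add: pu pred) (intro mono; simp)
    have "res n (- 1) (2 * int (n div 2)) (2 * int (n div 2) + 1) \<le> res n (- 1) (2 * int j) (2 * int j + 1)"
      by (intro res_1_le) simp
    also have "\<dots> \<le> res n (- 1) (2 * int j) (2 * int i + 1)"
      using * n by (intro mono) auto
    finally show "r (Vp (n div 2)) (Vu (n div 2)) \<le> r (Vp j) (Vu i)"
      using \<open>i < n\<close> \<open>j < n\<close> half by (simp add: pu)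
  next
    fix j i assume *: "j \<le> i" "i \<le> n - 1"
    then have "i < n" "j < n" using n by simp_all
    then show "r (Vp j) (Vv i) \<le> r (Vp 0) (Vv (n - 1))"
      using n * by (simp add: pv pred) (intro mono; simp)
    have "res n 1 (2 * int (n div 2)) (2 * int (n div 2) + 1) \<le> res n 1 (2 * int j) (2 * int j + 1)"
      by (intro res_1_le) simp
    also have "\<dots> \<le> res n 1 (2 * int j) (2 * int i + 1)"
      using * n by (intro mono) auto
    finally show "r (Vp (n div 2)) (Vv (n div 2)) \<le> r (Vp j) (Vv i)"
      using \<open>i < n\<close> \<open>j < n\<close> half by (simp add: pv)
  qed
qed

end
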